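(* Let $0<\beta\neq 1$. Let $R_\beta\in(0,1)$ be the positive root of the equation $$\frac{3\left(1-(1-y)^{1-\beta}\right)}{1-\beta}-\frac{2\left((1-y)^{-\beta}-1\right)}{\beta}=0 .$$ Then for every $f(x)=\sum_{k=0}^{\infty}x^k a_k\in \mathcal{SRB}(\mathbb{B})$ (with $a_k\in\mathbb{O}$) and every $x\in\mathbb{B}$ with $0<|x|=r\le R_\beta$, $$\sum_{k=0}^{\infty}|x|^k\left(\frac{1}{k+1}\sum_{n=0}^{k}\frac{\Gamma(k-n+\beta)}{\Gamma(k-n+1)\Gamma(\beta)}|a_n|\right)\le \frac{1}{r}\left(\frac{1-(1-r)^{1-\beta}}{1-\beta}\right).$$ The radius $R_\beta$ cannot be improved, i.e. for every $r\in(R_\beta,1)$ there exists $f\in\mathcal{SRB}(\mathbb{B})$ for which this inequality fails for $|x|=r$.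
   Context: $\mathbb{O}$ is the real algebra of octonions, $\mathbb{O}=\mathbb{H}+l\mathbb{H}$ ($\mathbb{H}$ the quaternions) with $\overline{a+lb}=\overline a-lb$ and $(a+lb)(c+ld)=(ac-d\overline b)+l(\overline a d+cb)$, a non-commutative, non-associative, alternative division algebra. $|x|=\sqrt{x\overline x}$ is the Euclidean norm on $\mathbb{R}^8$; it is multiplicative. $\mathbb{B}=\{x\in\mathbb{O}:|x|<1\}$, $\mathbb{S}=\{I\in\mathbb{O}:I^2=-1\}$, and $\mathbb{D}$ is the open unit disk of $\mathbb{C}$. Slice regular functions on $\mathbb{B}$: a stem function on $\mathbb{D}$ is $F=F_1+iF_2:\mathbb{D}\to\mathbb{O}\otimes_{\mathbb{R}}\mathbb{C}$ with $\mathbb{O}$-valued components satisfying $F_1(\overline z)=F_1(z)$, $F_2(\overline z)=-F_2(z)$. It induces the slice function $f:\mathbb{B}\to\mathbb{O}$, $f(\alpha+I\beta)=F_1(\alpha+i\beta)+I F_2(\alpha+i\beta)$ for $I\in\mathbb{S}$ and real $\alpha,\beta$ with $\alpha+i\beta\in\mathbb{D}$. The function $f$ is slice regular if $F$ is $C^1$ and satisfies the Cauchy–Riemann equations $\partial_\alpha F_1=\partial_\beta F_2$, $\partial_\beta F_1=-\partial_\alpha F_2$ on $\mathbb{D}$. Every slice regular function on $\mathbb{B}$ has a convergent power series expansion $f(x)=\sum_{k=0}^\infty x^k a_k$ with $a_k\in\mathbb{O}$. $\mathcal{SRB}(\mathbb{B})$ is the class of slice regular functions $f$ on $\mathbb{B}$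 with $|f(x)|\le 1$ for all $x\in\mathbb{B}$. $\Gamma$ is the Gamma function. *)

theory Defs
  imports "HOL-Analysis.Analysis" "HOL-Real_Asymp.Real_Asymp"
begin

text \<open>The pair \<open>(a, b)\<close> stands for the quaternion \<open>a + b j\<close> with \<open>j z = cnj z j\<close> for complex \<open>z\<close>.
  As a product type it already carries the Euclidean norm of \<open>\<real>\<^sup>4\<close>.\<close>

type_synonym quaternion = "complex \<times> complex"

definition qmult :: "quaternion \<Rightarrow> quaternion \<Rightarrow> quaternion" (infixl \<open>\<cdot>\<^sub>q\<close> 70)
  where "x \<cdot>\<^sub>q y = (fst x * fst y - snd x * cnj (snd y), fst x * snd y + snd x * cnj (fst y))"

definition qcnj :: "quaternion \<Rightarrow> quaternion"
  where "qcnj x = (cnj (fst x), - snd x)"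

text \<open>The pair \<open>(a, b)\<close> stands for the octonion \<open>a + l b\<close>.  Again the library norm of the product
  type is the Euclidean norm, here of \<open>\<real>\<^sup>8\<close>; see \<open>omult_ocnj\<close>.\<close>

type_synonym octonion = "quaternion \<times> quaternion"

definition omult :: "octonion \<Rightarrow> octonion \<Rightarrow> octonion" (infixl \<open>\<cdot>\<^sub>o\<close> 70)
  where "x \<cdot>\<^sub>o y =
    (fst x \<cdot>\<^sub>q fst y - snd y \<cdot>\<^sub>q qcnj (snd x), qcnj (fst x) \<cdot>\<^sub>q snd y + fst y \<cdot>\<^sub>q snd x)"

definition ocnj :: "octonion \<Rightarrow> octonion"
  where "ocnj x = (qcnj (fst x), - snd x)"

definition oone :: octonion (\<open>1\<^sub>o\<close>)
  where "1\<^sub>o = ((1, 0), (0, 0))"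

lemma omult_oone [simp]: "x \<cdot>\<^sub>o 1\<^sub>o = x" "1\<^sub>o \<cdot>\<^sub>o x = x"
  by (simp_all add: omult_def oone_def qmult_def qcnj_def prod_eq_iff)

lemma omult_ocnj: "x \<cdot>\<^sub>o ocnj x = (norm x)\<^sup>2 *\<^sub>R 1\<^sub>o"
proof -
  obtain a b c d where x: "x = ((a, b), (c, d))"
    by (metis surj_pair)
  have "(norm x)\<^sup>2 = (norm a)\<^sup>2 + (norm b)\<^sup>2 + ((norm c)\<^sup>2 + (norm d)\<^sup>2)"
    by (simp add: x norm_Pair)
  then show ?thesis
    by (simp add: x omult_def ocnj_def oone_def qmult_def qcnj_def
        complex_eq_iff cmod_def power2_eq_square algebra_simps)
qed

lemma norm_octonion: "norm x = sqrt (Re (fst (fst (x \<cdot>\<^sub>o ocnj x))))"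
  by (simp add: omult_ocnj oone_def)

primrec opow :: "octonion \<Rightarrow> nat \<Rightarrow> octonion"
  where
    "opow x 0 = 1\<^sub>o"
  | "opow x (Suc k) = x \<cdot>\<^sub>o opow x k"

definition imag_units :: "octonion set"
  where "imag_units = {I. I \<cdot>\<^sub>o I = - 1\<^sub>o}"

text \<open>An element \<open>F\<^sub>1 + i F\<^sub>2\<close> of the complexification of the octonions is the pair
  \<open>(F\<^sub>1, F\<^sub>2)\<close>.\<close>

definition stem_function :: "(complex \<Rightarrow> octonion \<times> octonion) \<Rightarrow> bool"
  where "stem_function F \<longleftrightarrow>
    (\<forall>z\<in>ball 0 1. fst (F (cnj z)) = fst (F z) \<and> snd (F (cnj z)) = - snd (F z))"

text \<open>\<open>F' z\<close> is the total derivative, so \<open>F' z 1\<close> and \<open>F' z \<i>\<close> are the partial derivatives with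
  respect to the real and the imaginary part of \<open>z\<close>.\<close>

definition C1_Cauchy_Riemann :: "(complex \<Rightarrow> octonion \<times> octonion) \<Rightarrow> bool"
  where "C1_Cauchy_Riemann F \<longleftrightarrow>
    (\<exists>F' :: complex \<Rightarrow> complex \<Rightarrow>\<^sub>L (octonion \<times> octonion).
      continuous_on (ball 0 1) F' \<and>
      (\<forall>z\<in>ball 0 1. (F has_derivative blinfun_apply (F' z)) (at z) \<and>
        fst (blinfun_apply (F' z) 1) = snd (blinfun_apply (F' z) \<i>) \<and>
        fst (blinfun_apply (F' z) \<i>) = - snd (blinfun_apply (F' z) 1)))"

text \<open>Functions on the unit ball are total here; their values outside the ball are irrelevant.\<close>

definition induced_by :: "(octonion \<Rightarrow> octonion) \<Rightarrow> (complex \<Rightarrow> octonion \<times> octonion) \<Rightarrow> bool"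
  where "induced_by f F \<longleftrightarrow>
    (\<forall>I\<in>imag_units. \<forall>\<alpha> \<beta>. Complex \<alpha> \<beta> \<in> ball 0 1 \<longrightarrow>
      f (\<alpha> *\<^sub>R 1\<^sub>o + \<beta> *\<^sub>R I) = fst (F (Complex \<alpha> \<beta>)) + I \<cdot>\<^sub>o snd (F (Complex \<alpha> \<beta>)))"

definition slice_regular :: "(octonion \<Rightarrow> octonion) \<Rightarrow> bool"
  where "slice_regular f \<longleftrightarrow> (\<exists>F. stem_function F \<and> C1_Cauchy_Riemann F \<and> induced_by f F)"

definition SRB :: "(octonion \<Rightarrow> octonion) set"
  where "SRB = {f. slice_regular f \<and> (\<forall>x\<in>ball 0 1. norm (f x) \<le> 1)}"

definition has_expansion :: "(octonion \<Rightarrow> octonion) \<Rightarrow> (nat \<Rightarrow> octonion) \<Rightarrow> bool"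
  where "has_expansion f a \<longleftrightarrow> (\<forall>x\<in>ball 0 1. (\<lambda>k. opow x k \<cdot>\<^sub>o a k) sums f x)"

definition cesaro_coeff :: "real \<Rightarrow> (nat \<Rightarrow> octonion) \<Rightarrow> nat \<Rightarrow> real"
  where "cesaro_coeff \<beta> a k =
    1 / (real k + 1) *
    (\<Sum>n=0..k. Gamma (real (k - n) + \<beta>) / (Gamma (real (k - n) + 1) * Gamma \<beta>) * norm (a n))"

definition radius_fun :: "real \<Rightarrow> real \<Rightarrow> real"
  where "radius_fun \<beta> y =
    3 * (1 - (1 - y) powr (1 - \<beta>)) / (1 - \<beta>) - 2 * ((1 - y) powr (- \<beta>) - 1) / \<beta>"

lemma radius_fun_deriv:
  assumes "\<beta> > 0" "\<beta> \<noteq> 1" "y < 1"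
  shows "(radius_fun \<beta> has_real_derivative (1 - y) powr (- \<beta> - 1) * (1 - 3 * y)) (at y)"
proof -
  have "(1 - y) powr (- \<beta>) = (1 - y) powr (- \<beta> - 1) * (1 - y)"
    using assms powr_add[of "1 - y" "- \<beta> - 1" 1] by simp
  moreover have "(radius_fun \<beta> has_real_derivative
      3 * (1 - y) powr (- \<beta>) - 2 * (1 - y) powr (- \<beta> - 1)) (at y)"
    unfolding radius_fun_def
    by (rule derivative_eq_intros refl | use assms in simp)+
  moreover have "3 * (p * u) - 2 * p = p * (3 * u - 2)" for p u :: real
    by (simp add: algebra_simps)
  ultimately show ?thesis
    by simp
qed

lemma radius_fun_at_bot:
  assumes "\<beta> > 0" "\<beta> \<noteq> 1"
  shows "filterlim (radius_fun \<beta>) at_bot (at_left 1)"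
proof (cases "\<beta> < 1")
  case True
  then show ?thesis using assms unfolding radius_fun_def by real_asymp
next
  case False
  then have "\<beta> > 1" using assms by simp
  then show ?thesis unfolding radius_fun_def by real_asymp
qed

lemma ex1_radius:
  assumes "\<beta> > 0" "\<beta> \<noteq> 1"
  shows "\<exists>!R. 0 < R \<and> R < 1 \<and> radius_fun \<beta> R = 0"
proof -
  have cont: "continuous_on {a..b} (radius_fun \<beta>)" if "b < 1" for a b
    using that assms
    by (intro continuous_at_imp_continuous_on ballI DERIV_isCont[OF radius_fun_deriv]) auto
  have zero: "radius_fun \<beta> 0 = 0"
    by (simp add: radius_fun_def)
  have mvt: "\<exists>z>a. z < b \<and> radius_fun \<beta> b - radius_fun \<beta> a
      = (b - a) * ((1 - z) powr (- \<beta> - 1) * (1 - 3 * z))" if "a < b" "b < 1" for a b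
    using that(1) by (rule MVT2) (use that assms in \<open>auto intro: radius_fun_deriv\<close>)
  have crit: "\<exists>z>a. z < b \<and> z = 1 / 3"
    if ab: "a < b" "b < 1" "radius_fun \<beta> a = radius_fun \<beta> b" for a b
  proof -
    obtain z where "a < z" "z < b" "0 = (b - a) * ((1 - z) powr (- \<beta> - 1) * (1 - 3 * z))"
      using mvt[OF ab(1,2)] ab(3) by auto
    then show ?thesis using ab by auto
  qed
  have pos: "radius_fun \<beta> (1 / 3) > 0"
  proof -
    obtain z where z: "0 < z" "z < 1 / 3" and eq: "radius_fun \<beta> (1 / 3) - radius_fun \<beta> 0
        = (1 / 3 - 0) * ((1 - z) powr (- \<beta> - 1) * (1 - 3 * z))"
      using mvt[of 0 "1 / 3"] by auto
    have "0 < (1 / 3 - 0) * ((1 - z) powr (- \<beta> - 1) * (1 - 3 * z))"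
      using z by (intro mult_pos_pos) auto
    with eq show ?thesis
      unfolding zero by (metis diff_zero)
  qed
  have "\<forall>\<^sub>F y in at_left 1. radius_fun \<beta> y < 0"
    using radius_fun_at_bot[OF assms] by (simp add: filterlim_at_bot_dense)
  moreover have "\<forall>\<^sub>F y in at_left 1. y \<in> {1 / 3<..<1 :: real}"
    by (rule eventually_at_left_real) simp
  ultimately have "\<forall>\<^sub>F y in at_left 1. radius_fun \<beta> y < 0 \<and> y \<in> {1 / 3<..<1 :: real}"
    by (rule eventually_conj)
  then obtain y where y: "radius_fun \<beta> y < 0" "1 / 3 < y" "y < 1"
    using eventually_happens'[of "at_left (1 :: real)"] by auto
  then obtain R where R: "1 / 3 \<le> R" "R \<le> y" "radius_fun \<beta> R = 0"
    using IVT2'[of "radius_fun \<beta>" y 0 "1 / 3"] pos cont by auto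
  show ?thesis
  proof (rule ex1I[of _ R])
    show "0 < R \<and> R < 1 \<and> radius_fun \<beta> R = 0"
      using R y by auto
  next
    fix S assume S: "0 < S \<and> S < 1 \<and> radius_fun \<beta> S = 0"
    show "S = R"
      using crit[of 0 S] crit[of 0 R] crit[of S R] crit[of R S] S R y zero
      by (cases S R rule: linorder_cases) auto
  qed
qed

end

theory Submission
  imports Defs "HOL-Complex_Analysis.Riemann_Mapping"
begin

text \<open>The heart of the matter is the coefficient estimate \<open>|a\<^sub>n| \<le> 1 - |a\<^sub>0|\<^sup>2\<close>.
  For given \<open>n\<close> choose an imaginary unit \<open>I\<close> such that \<open>a\<^sub>n = c a\<^sub>0\<close> with \<open>c\<close> in the complex
  slice \<open>\<complex>\<^sub>I\<close> (if \<open>a\<^sub>0 = 0\<close>, let \<open>1\<close> replace \<open>a\<^sub>0\<close>).  The orthogonal projection onto the complex line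
  \<open>\<complex>\<^sub>I a\<^sub>0\<close> commutes with left multiplication by \<open>\<complex>\<^sub>I\<close>, so it turns the restriction of \<open>f\<close> to the
  slice into a scalar holomorphic function bounded by 1 whose coefficients of orders 0 and \<open>n\<close> have
  the norms of \<open>a\<^sub>0\<close> and \<open>a\<^sub>n\<close>.  Averaging it over the \<open>n\<close>-th roots of unity reduces the estimate
  to the Schwarz--Pick inequality at 0.

  With \<open>A = (1 - (1 - r)\<^bsup>1-\<beta>\<^esup>) / (r (1 - \<beta>))\<close> and \<open>B = ((1 - r)\<^bsup>-\<beta>\<^esup> - 1) / (r \<beta>)\<close>, the means of the
  binomial series with exponents \<open>-\<beta>\<close> and \<open>-\<beta> - 1\<close>, the sum in question is then at most
  \<open>s A + (1 - s\<^sup>2) (B - A)\<close> where \<open>s = |a\<^sub>0|\<close>.  This is at most \<open>A\<close> as soon as \<open>2 (B - A) \<le> A\<close>, that is,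
  as soon as \<open>radius_fun \<beta> r \<ge> 0\<close>.  The Moebius functions with zero \<open>c \<rightarrow> 1\<close> show sharpness.\<close>

section \<open>Coefficients of bounded holomorphic functions\<close>

text \<open>Follow \<open>f\<close> by the Moebius map taking \<open>f 0\<close> to 0 and apply the
  Schwarz lemma. Both want values in the open disc, hence the scaling by \<open>t < 1\<close> and
  the limit \<open>t\<close> to 1 at the end.\<close>

lemma Schwarz_Pick_at_0:
  assumes holf: "f holomorphic_on ball 0 1" and le1: "\<And>z. norm z < 1 \<Longrightarrow> norm (f z) \<le> 1"
  shows "norm (deriv f 0) \<le> 1 - (norm (f 0))\<^sup>2"
proof -
  have scaled: "t * norm (deriv f 0) \<le> 1 - t\<^sup>2 * (norm (f 0))\<^sup>2" if t: "t \<in> {0<..<1}" for t :: real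
  proof -
    define c where "c = of_real t * f 0"
    define h where "h = (\<lambda>z. Moebius_function 0 c (of_real t * f z))"
    have lt1: "norm (of_real t * f z) < 1" if "norm z < 1" for z
    proof -
      have "norm (of_real t * f z) \<le> t * 1"
        using t le1[OF that] by (simp add: norm_mult)
      then show ?thesis using t by simp
    qed
    have c: "norm c < 1" unfolding c_def by (rule lt1) simp
    have "(f has_field_derivative deriv f 0) (at 0)"
      using holf by (simp add: holomorphic_derivI[of f "ball 0 1"])
    moreover have nz: "1 - cnj c * c \<noteq> 0"
      using c by (metis complex_mod_mult_cnj mult.commute norm_one right_minus_eq
          less_irrefl power2_eq_square abs_square_less_1 abs_norm_cancel norm_of_real norm_power)
    \<comment> \<open>The numerator of the Moebius quotient vanishes at 0, so only one term of the
      quotient rule survives.\<close>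
    ultimately have "(h has_field_derivative of_real t * deriv f 0 / (1 - cnj c * c)) (at 0)"
      unfolding h_def Moebius_function_def
      by (auto intro!: derivative_eq_intros simp: c_def[symmetric] power2_eq_square)
    moreover have "norm (deriv h 0) \<le> 1"
    proof (rule Schwarz_Lemma(2))
      have "Moebius_function 0 c \<circ> (\<lambda>z. of_real t * f z) holomorphic_on ball 0 1"
        by (rule holomorphic_on_compose_gen[OF _ Moebius_function_holomorphic[OF c]])
          (use lt1 holf in \<open>auto intro!: holomorphic_intros\<close>)
      then show "h holomorphic_on ball 0 1" by (simp add: h_def o_def)
      show "h 0 = 0" by (simp add: h_def c_def Moebius_function_def)
      show "norm (h z) < 1" if "norm z < 1" for z
        unfolding h_def by (rule Moebius_function_norm_lt_1[OF c lt1[OF that]])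
      show "norm (0::complex) < 1" by simp
    qed
    ultimately have "norm (of_real t * deriv f 0 / (1 - cnj c * c)) \<le> 1"
      by (metis DERIV_imp_deriv)
    moreover have "1 - cnj c * c = of_real (1 - (norm c)\<^sup>2)"
      using complex_norm_square[of c] by (simp add: mult.commute)
    moreover have "(norm c)\<^sup>2 < 1"
      using c by (simp add: abs_square_less_1)
    ultimately have "t * norm (deriv f 0) \<le> 1 - (norm c)\<^sup>2"
      using t by (simp add: norm_mult norm_divide del: of_real_diff of_real_power)
    then show ?thesis using t by (simp add: c_def norm_mult power_mult_distrib)
  qed
  have "eventually (\<lambda>t. t \<in> {0<..<1}) (at_left (1::real))"
    by (rule eventually_at_left_real) simp
  then have ev: "eventually (\<lambda>t. t * norm (deriv f 0) \<le> 1 - t\<^sup>2 * (norm (f 0))\<^sup>2) (at_left 1)"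
    by eventually_elim (rule scaled)
  have "1 * norm (deriv f 0) \<le> 1 - 1\<^sup>2 * (norm (f 0))\<^sup>2"
    by (rule tendsto_le[OF trivial_limit_at_left_real _ _ ev]) (intro tendsto_intros)+
  then show ?thesis by simp
qed

text \<open>Averaging over the \<open>n\<close>-th roots of unity annihilates every coefficient
  whose index is not a multiple of \<open>n\<close>; what remains is a power series in
  \<open>z ^ n\<close>.\<close>

lemma powser_multisection:
  fixes b :: "nat \<Rightarrow> complex"
  assumes "\<And>z. norm z < 1 \<Longrightarrow> (\<lambda>k. b k * z ^ k) sums g z"
    and "0 < n" and z: "norm z < 1"
  defines "\<omega> \<equiv> \<lambda>j::nat. exp (2 * of_real pi * \<i> * of_nat j / of_nat n)"
  shows "(\<lambda>k. b (n * k) * (z ^ n) ^ k) sums ((\<Sum>j<n. g (\<omega> j * z)) / of_nat n)"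
proof -
  have norm_\<omega>: "norm (\<omega> j) = 1" for j
    by (simp add: \<omega>_def norm_exp_eq_Re)
  \<comment> \<open>This symmetry turns the sum over the roots into a geometric sum with ratio
    \<open>\<omega> k\<close>.\<close>
  have \<omega>_power: "\<omega> j ^ k = \<omega> k ^ j" for j k
    unfolding \<omega>_def exp_of_nat_mult[symmetric] by (simp add: mult_ac)
  have sum_\<omega>: "(\<Sum>j<n. \<omega> j ^ k) = (if n dvd k then of_nat n else 0)" for k
  proof (cases "n dvd k")
    case True
    then have "\<omega> k = 1"
      using complex_root_unity_eq_1[of n k] \<open>0 < n\<close> by (simp add: \<omega>_def)
    then show ?thesis using True by (simp add: \<omega>_power[of _ k])
  next
    case False
    then have "\<omega> k \<noteq> 1"
      using complex_root_unity_eq_1[of n k] \<open>0 < n\<close> by (simp add: \<omega>_def)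
    moreover have "\<omega> k ^ n = 1"
      unfolding \<omega>_def by (rule complex_root_unity) (use \<open>0 < n\<close> in simp)
    ultimately show ?thesis
      using False by (simp add: \<omega>_power[of _ k] sum_gp_strict)
  qed
  have "(\<lambda>k. \<Sum>j<n. b k * (\<omega> j * z) ^ k) sums (\<Sum>j<n. g (\<omega> j * z))"
    by (intro sums_sum assms) (simp add: norm_mult norm_\<omega> z)
  then have "(\<lambda>k. (\<Sum>j<n. b k * (\<omega> j * z) ^ k) / of_nat n) sums ((\<Sum>j<n. g (\<omega> j * z)) / of_nat n)"
    by (rule sums_divide)
  moreover have "(\<Sum>j<n. b k * (\<omega> j * z) ^ k) / of_nat n = (if n dvd k then b k * z ^ k else 0)" for k
  proof -
    have "(\<Sum>j<n. b k * (\<omega> j * z) ^ k) = b k * z ^ k * (\<Sum>j<n. \<omega> j ^ k)"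
      by (simp add: sum_distrib_left power_mult_distrib mult_ac)
    then show ?thesis using \<open>0 < n\<close> by (simp add: sum_\<omega>)
  qed
  ultimately have "(\<lambda>k. if n dvd k then b k * z ^ k else 0) sums ((\<Sum>j<n. g (\<omega> j * z)) / of_nat n)"
    by simp
  \<comment> \<open>Only indices in the range of \<open>k -> n * k\<close> carry nonzero terms, so
    the series may be reindexed along it.\<close>
  then have "(\<lambda>k. if n dvd n * k then b (n * k) * z ^ (n * k) else 0)
      sums ((\<Sum>j<n. g (\<omega> j * z)) / of_nat n)"
    by (subst sums_mono_reindex[of "\<lambda>k. n * k"]) (use \<open>0 < n\<close> in \<open>auto simp: strict_mono_def\<close>)
  then show ?thesis by (simp add: power_mult)
qed

text \<open>The averaged function, read as a function \<open>G\<close> of \<open>w = z ^ n\<close>,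
  is still bounded by 1, and it has \<open>G 0 = b 0\<close> and
  \<open>deriv G 0 = b n\<close>.\<close>

lemma bounded_powser_coeff_le:
  fixes b :: "nat \<Rightarrow> complex"
  assumes sums: "\<And>z. norm z < 1 \<Longrightarrow> (\<lambda>k. b k * z ^ k) sums g z"
    and le1: "\<And>z. norm z < 1 \<Longrightarrow> norm (g z) \<le> 1"
    and n: "0 < n"
  shows "norm (b n) \<le> 1 - (norm (b 0))\<^sup>2"
proof -
  define G where "G = (\<lambda>w. \<Sum>k. b (n * k) * w ^ k)"
  have G: "(\<lambda>k. b (n * k) * w ^ k) sums G w \<and> norm (G w) \<le> 1" if w: "norm w < 1" for w
  proof -
    \<comment> \<open>Any root will do, since \<open>G w\<close> is defined by its series and
      depends on \<open>w\<close> alone.\<close>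
    obtain z where zw: "z ^ n = w"
      using exists_complex_root[of n w] n by blast
    have z: "norm z < 1"
    proof (rule ccontr)
      assume "\<not> norm z < 1"
      then have "1 \<le> norm z ^ n" by simp
      then show False using w zw by (simp add: norm_power[symmetric])
    qed
    define \<omega> where "\<omega> = (\<lambda>j::nat. exp (2 * complex_of_real pi * \<i> * of_nat j / of_nat n))"
    have mean: "(\<lambda>k. b (n * k) * w ^ k) sums ((\<Sum>j<n. g (\<omega> j * z)) / of_nat n)"
      using powser_multisection[of b g, OF sums n z] zw unfolding \<omega>_def by simp
    moreover have "norm (\<Sum>j<n. g (\<omega> j * z)) \<le> real (card {..<n}) * 1"
      by (rule sum_norm_bound, rule le1) (simp add: norm_mult \<omega>_def norm_exp_eq_Re z)
    moreover have "G w = (\<Sum>j<n. g (\<omega> j * z)) / of_nat n"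
      unfolding G_def by (rule sums_unique[OF mean, symmetric])
    ultimately show ?thesis
      using n by (simp add: norm_divide)
  qed
  have "G holomorphic_on ball 0 1"
    by (rule power_series_holomorphic[where a = "\<lambda>k. b (n * k)"]) (use G in auto)
  then have "norm (deriv G 0) \<le> 1 - (norm (G 0))\<^sup>2"
    by (rule Schwarz_Pick_at_0) (use G in blast)
  moreover have "(G has_field_derivative (\<Sum>k. diffs (\<lambda>k. b (n * k)) k * 0 ^ k)) (at 0)"
    unfolding G_def by (rule termdiffs_strong'[of 1]) (use G in \<open>auto dest: sums_summable\<close>)
  then have "deriv G 0 = b n"
    by (simp add: DERIV_imp_deriv diffs_def)
  moreover have "G 0 = b 0"
    by (simp add: G_def)
  ultimately show ?thesis by simp
qed

section \<open>Complex slices of the octonions\<close>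

text \<open>An explicit description of imaginary units, convenient for norms and inner products;
  \<open>imag_sphere_square\<close> links it to the equation defining
  \<open>imag_units\<close>.\<close>

definition imag_sphere :: "octonion set"
  where "imag_sphere = {I. norm I = 1 \<and> Re (fst (fst I)) = 0}"

text \<open>Reduces octonion identities to polynomial identities in the eight real
  coordinates.\<close>

lemmas octonion_simps = omult_def oone_def ocnj_def qmult_def qcnj_def prod_eq_iff
  complex_eq_iff inner_prod_def inner_complex_def

lemma omult_linear:
  "(x + y) \<cdot>\<^sub>o v = x \<cdot>\<^sub>o v + y \<cdot>\<^sub>o v" "x \<cdot>\<^sub>o (v + w) = x \<cdot>\<^sub>o v + x \<cdot>\<^sub>o w"
  "(c *\<^sub>R x) \<cdot>\<^sub>o v = c *\<^sub>R (x \<cdot>\<^sub>o v)" "x \<cdot>\<^sub>o (c *\<^sub>R v) = c *\<^sub>R (x \<cdot>\<^sub>o v)"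
  "(- x) \<cdot>\<^sub>o v = - (x \<cdot>\<^sub>o v)" "x \<cdot>\<^sub>o (- v) = - (x \<cdot>\<^sub>o v)"
  by (simp_all add: octonion_simps algebra_simps)

text \<open>Skew-adjointness; with \<open>omult_omult_imag\<close> it makes left multiplication by a
  unit \<open>I\<close> an orthogonal complex structure.\<close>

lemma inner_omult_imag:
  assumes "Re (fst (fst x)) = 0"
  shows "inner (x \<cdot>\<^sub>o v) w = - inner v (x \<cdot>\<^sub>o w)"
  using assms by (simp add: octonion_simps algebra_simps)

text \<open>An instance of the left alternative law, as an imaginary \<open>x\<close> has square
  \<open>- (norm x)\<^sup>2\<close>.\<close>

lemma omult_omult_imag:
  assumes "Re (fst (fst x)) = 0"
  shows "x \<cdot>\<^sub>o (x \<cdot>\<^sub>o v) = - (norm x)\<^sup>2 *\<^sub>R v"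
  using assms unfolding power2_norm_eq_inner
  by (simp add: octonion_simps algebra_simps)

text \<open>An instance of alternativity that permits right division although the product is not
  associative.\<close>

lemma omult_ocnj_cancel: "(x \<cdot>\<^sub>o ocnj y) \<cdot>\<^sub>o y = (norm y)\<^sup>2 *\<^sub>R x"
  unfolding power2_norm_eq_inner by (simp add: octonion_simps algebra_simps)

lemma imag_sphere_decomp:
  obtains I \<alpha> \<beta> where "I \<in> imag_sphere" "x = \<alpha> *\<^sub>R 1\<^sub>o + \<beta> *\<^sub>R I"
proof -
  define \<alpha> where "\<alpha> = Re (fst (fst x))"
  define y where "y = x - \<alpha> *\<^sub>R 1\<^sub>o"
  have y: "Re (fst (fst y)) = 0" by (simp add: y_def \<alpha>_def oone_def)
  have x: "x = \<alpha> *\<^sub>R 1\<^sub>o + y" by (simp add: y_def)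
  show ?thesis
  proof (cases "y = 0")
    case True
    \<comment> \<open>For real \<open>x\<close> any imaginary unit serves.\<close>
    then have "x = \<alpha> *\<^sub>R 1\<^sub>o + 0 *\<^sub>R ((\<i>, 0), (0, 0))" by (simp add: x zero_prod_def)
    moreover have "((\<i>, 0), (0, 0)) \<in> imag_sphere"
      by (simp add: imag_sphere_def norm_Pair)
    ultimately show ?thesis using that by blast
  next
    case False
    then have "x = \<alpha> *\<^sub>R 1\<^sub>o + norm y *\<^sub>R (y /\<^sub>R norm y)" by (simp add: x)
    moreover have "y /\<^sub>R norm y \<in> imag_sphere"
      using False y by (simp add: imag_sphere_def)
    ultimately show ?thesis using that by blast
  qed
qed

text \<open>Skew-adjointness makes \<open>u\<close> and \<open>I \<cdot>\<^sub>o u\<close>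
  orthonormal. The case \<open>u = 1\<^sub>o\<close> gives the norm on the slice itself.\<close>

lemma norm_slice:
  assumes "I \<in> imag_sphere" "norm u = 1"
  shows "norm (\<alpha> *\<^sub>R u + \<beta> *\<^sub>R (I \<cdot>\<^sub>o u)) = norm (Complex \<alpha> \<beta>)"
proof -
  have I: "Re (fst (fst I)) = 0" "norm I = 1" using assms by (auto simp: imag_sphere_def)
  have 1: "inner u (I \<cdot>\<^sub>o u) = 0"
    using inner_omult_imag[OF I(1), of u u] by (simp add: inner_commute)
  have 2: "inner (I \<cdot>\<^sub>o u) (I \<cdot>\<^sub>o u) = 1"
    using assms(2) by (simp add: inner_omult_imag[OF I(1)] omult_omult_imag[OF I(1)] I(2) norm_eq_1)
  have "(norm (\<alpha> *\<^sub>R u + \<beta> *\<^sub>R (I \<cdot>\<^sub>o u)))\<^sup>2 = \<alpha>\<^sup>2 + \<beta>\<^sup>2"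
    unfolding power2_norm_eq_inner
    using assms(2) 1 2 by (simp add: inner_simps norm_eq_1 power2_eq_square inner_commute)
  then show ?thesis by (simp add: cmod_def real_sqrt_unique)
qed

lemma opow_slice:
  assumes "I \<cdot>\<^sub>o I = - 1\<^sub>o"
  shows "opow (\<alpha> *\<^sub>R 1\<^sub>o + \<beta> *\<^sub>R I) k = Re (Complex \<alpha> \<beta> ^ k) *\<^sub>R 1\<^sub>o + Im (Complex \<alpha> \<beta> ^ k) *\<^sub>R I"
  by (induction k) (simp_all add: omult_linear assms algebra_simps)

text \<open>For a unit vector \<open>u\<close> and \<open>I\<close> in \<open>imag_sphere\<close>
  this is the complex coordinate, in the orthonormal basis \<open>u\<close>,
  \<open>I \<cdot>\<^sub>o u\<close>, of the orthogonal projection of \<open>v\<close> onto the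
  complex line through \<open>u\<close>.\<close>

definition slice_coord :: "octonion \<Rightarrow> octonion \<Rightarrow> octonion \<Rightarrow> complex"
  where "slice_coord I u v = Complex (inner v u) (inner v (I \<cdot>\<^sub>o u))"

lemma bounded_linear_slice_coord: "bounded_linear (slice_coord I u)"
proof -
  have eq: "slice_coord I u = (\<lambda>v. of_real (inner v u) + \<i> * of_real (inner v (I \<cdot>\<^sub>o u)))"
    by (simp add: slice_coord_def complex_eq_iff fun_eq_iff)
  show ?thesis unfolding eq
    by (intro bounded_linear_add bounded_linear_const_mult
        bounded_linear_compose[OF bounded_linear_of_real bounded_linear_inner_left])
qed

text \<open>Complex linearity of the projection, from skew-adjointness and
  \<open>I (I u) = - u\<close>. It turns octonionic power series on a slice into complex
  ones.\<close>

lemma slice_coord_slice: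
  assumes "I \<in> imag_sphere"
  shows "slice_coord I u ((\<alpha> *\<^sub>R 1\<^sub>o + \<beta> *\<^sub>R I) \<cdot>\<^sub>o v) = Complex \<alpha> \<beta> * slice_coord I u v"
proof -
  have I: "Re (fst (fst I)) = 0" "norm I = 1" using assms by (auto simp: imag_sphere_def)
  show ?thesis
    by (simp add: slice_coord_def complex_eq_iff omult_linear inner_simps inner_omult_imag[OF I(1)]
        omult_omult_imag[OF I(1)] I(2))
qed

text \<open>Cauchy-Schwarz for \<open>v\<close> and its projection \<open>w\<close>, whose inner
  product with \<open>v\<close> is the squared norm of the coordinate.\<close>

lemma norm_slice_coord_le:
  assumes "I \<in> imag_sphere" "norm u = 1"
  shows "norm (slice_coord I u v) \<le> norm v"
proof -
  define c where "c = slice_coord I u v"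
  define w where "w = Re c *\<^sub>R u + Im c *\<^sub>R (I \<cdot>\<^sub>o u)"
  have w: "norm w = norm c" unfolding w_def by (simp add: norm_slice[OF assms])
  have "norm c * norm c = inner v w"
    by (simp add: w_def inner_simps c_def slice_coord_def cmod_def flip: power2_eq_square)
  also have "\<dots> \<le> norm v * norm c"
    using norm_cauchy_schwarz[of v w] by (simp add: w)
  finally show ?thesis unfolding c_def[symmetric]
    by (metis mult_right_le_imp_le norm_ge_zero norm_zero order_le_less zero_less_norm_iff)
qed

lemma imag_sphere_square: "I \<in> imag_sphere \<Longrightarrow> I \<cdot>\<^sub>o I = - 1\<^sub>o"
  using omult_omult_imag[of I "1\<^sub>o"] by (simp add: imag_sphere_def)

section \<open>Means of binomial series\<close>

lemma Gamma_ratio_eq_pochhammer: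
  assumes "0 < \<beta>"
  shows "Gamma (real k + \<beta>) / (Gamma (real k + 1) * Gamma \<beta>) = pochhammer \<beta> k / fact k"
proof -
  have "\<beta> \<notin> \<int>\<^sub>\<le>\<^sub>0" using assms by (auto elim!: nonpos_Ints_cases)
  moreover have "Gamma (real k + 1) = fact k" by (simp add: Gamma_fact add.commute)
  ultimately show ?thesis
    by (simp add: pochhammer_Gamma add.commute)
qed

lemma pochhammer_series_sums:
  fixes s x :: real
  assumes "\<bar>x\<bar> < 1"
  shows "(\<lambda>k. pochhammer s k / fact k * x ^ k) sums (1 - x) powr (- s)"
proof -
  have "pochhammer s k / fact k * x ^ k = (- s gchoose k) * (- x) ^ k" for k
  proof -
    have "(- 1) ^ k * (- x) ^ k = x ^ k" by (simp flip: power_mult_distrib)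
    then show ?thesis by (simp add: gbinomial_pochhammer mult_ac)
  qed
  then show ?thesis using gen_binomial_real[of "- x" "- s"] assms by simp
qed

text \<open>The factor \<open>1 / (k + 1)\<close> amounts to integrating the binomial series.
  Concretely, the terms are those of the series of \<open>(1 - r) powr (1 - s)\<close> shifted by
  one index and divided by \<open>r * (s - 1)\<close>.\<close>

lemma pochhammer_mean_series_sums:
  fixes s r :: real
  assumes "0 < r" "r < 1" "s \<noteq> 1"
  shows "(\<lambda>k. r ^ k * (pochhammer s k / fact k / (real k + 1)))
    sums (1 / r * ((1 - (1 - r) powr (1 - s)) / (1 - s)))"
proof -
  let ?f = "\<lambda>k. pochhammer (s - 1) k / fact k * r ^ k"
  have "?f sums (1 - r) powr (1 - s)"
    using pochhammer_series_sums[of r "s - 1"] assms by simp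
  then have "(\<lambda>k. ?f (Suc k)) sums ((1 - r) powr (1 - s) - 1)"
    by (subst sums_Suc_iff) simp
  then have "(\<lambda>k. ?f (Suc k) / (r * (s - 1))) sums (((1 - r) powr (1 - s) - 1) / (r * (s - 1)))"
    by (rule sums_divide)
  moreover have "?f (Suc k) / (r * (s - 1)) = r ^ k * (pochhammer s k / fact k / (real k + 1))" for k
  proof -
    have "?f (Suc k) = r ^ k * (pochhammer s k / fact k / (real k + 1)) * (r * (s - 1))"
      by (simp add: pochhammer_rec mult_ac add.commute)
    then show ?thesis using assms by simp
  qed
  moreover have "((1 - r) powr (1 - s) - 1) / (r * (s - 1)) = 1 / r * ((1 - (1 - r) powr (1 - s)) / (1 - s))"
    using assms by (simp add: field_simps)
  ultimately show ?thesis by simp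
qed

lemma pochhammer_Suc_mean_series_sums:
  fixes s r :: real
  assumes "0 < r" "r < 1" "0 < s"
  shows "(\<lambda>k. r ^ k * (pochhammer (s + 1) k / fact k / (real k + 1)))
    sums (1 / r * (((1 - r) powr - s - 1) / s))"
proof -
  have "1 / r * ((1 - (1 - r) powr (1 - (s + 1))) / (1 - (s + 1))) = 1 / r * (((1 - r) powr - s - 1) / s)"
    using assms by (simp add: field_simps)
  then show ?thesis
    using pochhammer_mean_series_sums[of r "s + 1"] assms by simp
qed

text \<open>Coefficient form of dividing the binomial series with exponent \<open>- s\<close> by
  \<open>1 - x\<close>, which lowers the exponent by one.\<close>

lemma sum_pochhammer_over_fact:
  fixes s :: real
  shows "(\<Sum>j\<le>k. pochhammer s j / fact j) = pochhammer (s + 1) k / fact k"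
proof (induction k)
  case (Suc k)
  have "pochhammer (s + 1) k / fact k + pochhammer s (Suc k) / fact (Suc k)
      = pochhammer (s + 1) (Suc k) / fact (Suc k)"
    unfolding pochhammer_rec[of s] pochhammer_rec'[of "s + 1"] fact_Suc
    by (simp add: divide_simps) (simp add: algebra_simps)
  then show ?case by (simp add: Suc.IH)
qed simp

lemma pochhammer_over_fact_mono:
  fixes s :: real
  assumes "0 < s"
  shows "pochhammer s k / fact k \<le> pochhammer (s + 1) k / fact k"
proof -
  have "pochhammer s k / fact k \<le> (\<Sum>j\<le>k. pochhammer s j / fact j)"
    by (rule member_le_sum) (use assms in \<open>auto intro!: divide_nonneg_pos pochhammer_nonneg\<close>)
  then show ?thesis by (simp add: sum_pochhammer_over_fact)
qed

text \<open>Termwise comparison of the two series; in the notation of the overview,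
  \<open>A \<le> B\<close>.\<close>

lemma powr_mean_le:
  fixes s r :: real
  assumes "0 < r" "r < 1" "0 < s" "s \<noteq> 1"
  shows "1 / r * ((1 - (1 - r) powr (1 - s)) / (1 - s)) \<le> 1 / r * (((1 - r) powr - s - 1) / s)"
proof (rule sums_le[OF _ pochhammer_mean_series_sums pochhammer_Suc_mean_series_sums])
  show "r ^ k * (pochhammer s k / fact k / (real k + 1))
      \<le> r ^ k * (pochhammer (s + 1) k / fact k / (real k + 1))" for k
    using assms by (intro mult_left_mono divide_right_mono pochhammer_over_fact_mono) auto
qed (use assms in auto)

section \<open>Comparison of \<open>cesaro_coeff\<close> with sequences constant from index 1
  on\<close>

lemma cesaro_coeff_eq:
  assumes "0 < \<beta>"
  shows "cesaro_coeff \<beta> a k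
    = (\<Sum>n\<le>k. pochhammer \<beta> (k - n) / fact (k - n) * norm (a n)) / (real k + 1)"
  unfolding cesaro_coeff_def Gamma_ratio_eq_pochhammer[OF assms] by (simp add: atLeast0AtMost)

text \<open>The sequence \<open>s, t, t, ...\<close> is the constant \<open>t\<close> plus
  \<open>s - t\<close> at index 0; the constant part is summed by
  \<open>sum_pochhammer_over_fact\<close>. After division by \<open>k + 1\<close> the two terms
  belong to the series of \<open>A\<close> and \<open>B - A\<close>.\<close>

lemma sum_pochhammer_step:
  fixes \<beta> s t :: real
  shows "(\<Sum>n\<le>k. pochhammer \<beta> (k - n) / fact (k - n) * (if n = 0 then s else t))
    = s * (pochhammer \<beta> k / fact k) + t * (pochhammer (\<beta> + 1) k / fact k - pochhammer \<beta> k / fact k)"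
proof -
  have "(\<Sum>n\<le>k. pochhammer \<beta> (k - n) / fact (k - n) * (if n = 0 then s else t))
      = (\<Sum>n\<le>k. t * (pochhammer \<beta> (k - n) / fact (k - n))
          + (if n = 0 then (s - t) * (pochhammer \<beta> k / fact k) else 0))"
    by (rule sum.cong) (auto simp: algebra_simps diff_divide_distrib)
  also have "\<dots> = t * (\<Sum>n\<le>k. pochhammer \<beta> (k - n) / fact (k - n)) + (s - t) * (pochhammer \<beta> k / fact k)"
    by (simp add: sum.distrib sum_distrib_left)
  also have "(\<Sum>n\<le>k. pochhammer \<beta> (k - n) / fact (k - n)) = (\<Sum>j\<le>k. pochhammer \<beta> j / fact j)"
    by (rule sum.reindex_bij_witness[of _ "\<lambda>j. k - j" "\<lambda>j. k - j"]) auto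
  finally show ?thesis
    by (simp add: sum_pochhammer_over_fact algebra_simps diff_divide_distrib)
qed

lemma cesaro_coeff_upper:
  assumes "0 < \<beta>" "norm (a 0) \<le> s" "\<And>n. n \<in> {1..k} \<Longrightarrow> norm (a n) \<le> t"
  shows "cesaro_coeff \<beta> a k \<le> s * (pochhammer \<beta> k / fact k / (real k + 1))
    + t * (pochhammer (\<beta> + 1) k / fact k / (real k + 1) - pochhammer \<beta> k / fact k / (real k + 1))"
proof -
  have "(\<Sum>n\<le>k. pochhammer \<beta> (k - n) / fact (k - n) * norm (a n))
      \<le> (\<Sum>n\<le>k. pochhammer \<beta> (k - n) / fact (k - n) * (if n = 0 then s else t))"
    by (intro sum_mono mult_left_mono) (use assms in \<open>auto intro!: divide_nonneg_pos pochhammer_nonneg\<close>)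
  then have "cesaro_coeff \<beta> a k \<le> (s * (pochhammer \<beta> k / fact k)
      + t * (pochhammer (\<beta> + 1) k / fact k - pochhammer \<beta> k / fact k)) / (real k + 1)"
    unfolding cesaro_coeff_eq[OF assms(1)] sum_pochhammer_step by (intro divide_right_mono) auto
  then show ?thesis by (simp add: add_divide_distrib diff_divide_distrib right_diff_distrib)
qed

text \<open>Only the indices up to \<open>k\<close> enter, so \<open>t\<close> may be chosen
  separately for each \<open>k\<close>; the truncation in the sharpness proof relies on
  this.\<close>

lemma cesaro_coeff_lower:
  assumes "0 < \<beta>" "s \<le> norm (a 0)" "\<And>n. n \<in> {1..k} \<Longrightarrow> t \<le> norm (a n)"
  shows "s * (pochhammer \<beta> k / fact k / (real k + 1))
    + t * (pochhammer (\<beta> + 1) k / fact k / (real k + 1) - pochhammer \<beta> k / fact k / (real k + 1))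
    \<le> cesaro_coeff \<beta> a k"
proof -
  have "(\<Sum>n\<le>k. pochhammer \<beta> (k - n) / fact (k - n) * (if n = 0 then s else t))
      \<le> (\<Sum>n\<le>k. pochhammer \<beta> (k - n) / fact (k - n) * norm (a n))"
    by (intro sum_mono mult_left_mono) (use assms in \<open>auto intro!: divide_nonneg_pos pochhammer_nonneg\<close>)
  then have "(s * (pochhammer \<beta> k / fact k)
      + t * (pochhammer (\<beta> + 1) k / fact k - pochhammer \<beta> k / fact k)) / (real k + 1)
      \<le> cesaro_coeff \<beta> a k"
    unfolding cesaro_coeff_eq[OF assms(1)] sum_pochhammer_step by (intro divide_right_mono) auto
  then show ?thesis by (simp add: add_divide_distrib diff_divide_distrib right_diff_distrib)
qed

lemma cesaro_coeff_nonneg: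
  assumes "0 < \<beta>"
  shows "0 \<le> cesaro_coeff \<beta> a k"
  unfolding cesaro_coeff_eq[OF assms]
  by (intro divide_nonneg_pos sum_nonneg mult_nonneg_nonneg)
    (use assms in \<open>auto intro!: pochhammer_nonneg\<close>)

section \<open>Sign of the radius function\<close>

text \<open>By its derivative, the function increases up to \<open>1 / 3\<close> and decreases
  afterwards. It vanishes at 0 and \<open>R\<close>, so it is nonnegative between them and negative
  beyond \<open>R\<close>.\<close>

lemma radius_fun_sign:
  assumes "0 < \<beta>" "\<beta> \<noteq> 1" "0 < R" "R < 1" "radius_fun \<beta> R = 0"
  shows "\<lbrakk>0 < r; r \<le> R\<rbrakk> \<Longrightarrow> 0 \<le> radius_fun \<beta> r"
    and "\<lbrakk>R < r; r < 1\<rbrakk> \<Longrightarrow> radius_fun \<beta> r < 0"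
proof -
  have mvt: "\<exists>z>a. z < b \<and> radius_fun \<beta> b - radius_fun \<beta> a
      = (b - a) * ((1 - z) powr (- \<beta> - 1) * (1 - 3 * z))" if "a < b" "b < 1" for a b
    using that(1) by (rule MVT2) (use that assms in \<open>auto intro: radius_fun_deriv\<close>)
  have zero: "radius_fun \<beta> 0 = 0" by (simp add: radius_fun_def)
  obtain z where z: "0 < z" "z < R" "radius_fun \<beta> R - radius_fun \<beta> 0
      = (R - 0) * ((1 - z) powr (- \<beta> - 1) * (1 - 3 * z))"
    using mvt[OF assms(3,4)] by auto
  \<comment> \<open>Equal values at 0 and \<open>R\<close> force the intermediate point
    \<open>z\<close> to be the critical point \<open>1 / 3\<close>.\<close>
  then have R: "R > 1 / 3" using assms zero by auto
  show "radius_fun \<beta> r < 0" if r: "R < r" "r < 1"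
  proof -
    obtain z where z: "R < z" "z < r" "radius_fun \<beta> r - radius_fun \<beta> R
        = (r - R) * ((1 - z) powr (- \<beta> - 1) * (1 - 3 * z))"
      using mvt[OF r] by auto
    have "(r - R) * ((1 - z) powr (- \<beta> - 1) * (1 - 3 * z)) < 0"
      using z R r by (intro mult_pos_neg) auto
    then show ?thesis using z assms by simp
  qed
  show "0 \<le> radius_fun \<beta> r" if r: "0 < r" "r \<le> R"
  proof (cases "r = R")
    case False
    show ?thesis
    proof (cases "r \<le> 1 / 3")
      case True
      obtain z where z: "0 < z" "z < r" "radius_fun \<beta> r - radius_fun \<beta> 0
          = (r - 0) * ((1 - z) powr (- \<beta> - 1) * (1 - 3 * z))"
        using mvt[of 0 r] r assms by auto
      have "0 \<le> (r - 0) * ((1 - z) powr (- \<beta> - 1) * (1 - 3 * z))"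
        using z True r by (intro mult_nonneg_nonneg) auto
      then show ?thesis using z zero by simp
    next
      case r3: False
      obtain z where z: "r < z" "z < R" "radius_fun \<beta> R - radius_fun \<beta> r
          = (R - r) * ((1 - z) powr (- \<beta> - 1) * (1 - 3 * z))"
        using mvt[of r R] r False assms by auto
      have "(R - r) * ((1 - z) powr (- \<beta> - 1) * (1 - 3 * z)) \<le> 0"
        using z r3 r by (intro mult_nonneg_nonpos) auto
      then show ?thesis using z assms by simp
    qed
  qed (use assms in simp)
qed

section \<open>Slice regular functions bounded by one\<close>

text \<open>With real coefficients the series maps each slice to itself and acts there as
  \<open>g\<close>. Hence the norm bound carries over, and the real and imaginary parts of
  \<open>g\<close> form the stem function.\<close>

lemma SRB_of_real_powser:
  fixes q :: "nat \<Rightarrow> real" and g :: "complex \<Rightarrow> complex"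
  assumes sums: "\<And>z. norm z < 1 \<Longrightarrow> (\<lambda>k. of_real (q k) * z ^ k) sums g z"
    and le1: "\<And>z. norm z < 1 \<Longrightarrow> norm (g z) \<le> 1"
  shows "\<exists>f\<in>SRB. has_expansion f (\<lambda>k. q k *\<^sub>R 1\<^sub>o)"
proof -
  define f where "f x = (\<Sum>k. opow x k \<cdot>\<^sub>o (q k *\<^sub>R 1\<^sub>o))" for x
  define L where "L w = (Re w *\<^sub>R 1\<^sub>o, Im w *\<^sub>R 1\<^sub>o)" for w
  define F where "F = (\<lambda>z. L (g z))"
  \<comment> \<open>Stated for every square root of \<open>- 1\<^sub>o\<close>, to cover both
    \<open>imag_sphere\<close> in the norm bound and \<open>imag_units\<close> in
    \<open>induced_by\<close>.\<close>
  have slice_sums: "(\<lambda>k. opow (\<alpha> *\<^sub>R 1\<^sub>o + \<beta> *\<^sub>R I) k \<cdot>\<^sub>o (q k *\<^sub>R 1\<^sub>o))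
      sums (Re (g (Complex \<alpha> \<beta>)) *\<^sub>R 1\<^sub>o + Im (g (Complex \<alpha> \<beta>)) *\<^sub>R I)"
    if "I \<cdot>\<^sub>o I = - 1\<^sub>o" "norm (Complex \<alpha> \<beta>) < 1" for I \<alpha> \<beta>
  proof -
    let ?z = "Complex \<alpha> \<beta>"
    have "(\<lambda>k. Re (of_real (q k) * ?z ^ k) *\<^sub>R 1\<^sub>o + Im (of_real (q k) * ?z ^ k) *\<^sub>R I)
        sums (Re (g ?z) *\<^sub>R 1\<^sub>o + Im (g ?z) *\<^sub>R I)"
      using sums[OF that(2)]
      by (intro sums_add bounded_linear.sums[OF bounded_linear_scaleR_left] sums_Re sums_Im)
    moreover have "opow (\<alpha> *\<^sub>R 1\<^sub>o + \<beta> *\<^sub>R I) k \<cdot>\<^sub>o (q k *\<^sub>R 1\<^sub>o)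
        = Re (of_real (q k) * ?z ^ k) *\<^sub>R 1\<^sub>o + Im (of_real (q k) * ?z ^ k) *\<^sub>R I" for k
      by (simp add: opow_slice[OF that(1)] omult_linear algebra_simps)
    ultimately show ?thesis by simp
  qed
  have on_ball: "(\<lambda>k. opow x k \<cdot>\<^sub>o (q k *\<^sub>R 1\<^sub>o)) sums f x \<and> norm (f x) \<le> 1" if "x \<in> ball 0 1" for x
  proof -
    obtain I \<alpha> \<beta> where I: "I \<in> imag_sphere" and x: "x = \<alpha> *\<^sub>R 1\<^sub>o + \<beta> *\<^sub>R I"
      by (rule imag_sphere_decomp)
    have one: "norm 1\<^sub>o = 1" by (simp add: oone_def norm_Pair)
    have z: "norm (Complex \<alpha> \<beta>) < 1"
      using that norm_slice[OF I one, of \<alpha> \<beta>] by (simp add: x)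
    from slice_sums[OF imag_sphere_square[OF I] z]
    have s: "(\<lambda>k. opow x k \<cdot>\<^sub>o (q k *\<^sub>R 1\<^sub>o))
        sums (Re (g (Complex \<alpha> \<beta>)) *\<^sub>R 1\<^sub>o + Im (g (Complex \<alpha> \<beta>)) *\<^sub>R I)"
      by (simp add: x)
    then have "f x = Re (g (Complex \<alpha> \<beta>)) *\<^sub>R 1\<^sub>o + Im (g (Complex \<alpha> \<beta>)) *\<^sub>R I"
      by (simp add: f_def sums_iff)
    then have "norm (f x) = norm (g (Complex \<alpha> \<beta>))"
      using norm_slice[OF I one] by simp
    then show ?thesis using s le1[OF z] by (simp add: f_def sums_iff)
  qed
  have holg: "g holomorphic_on ball 0 1"
    by (rule power_series_holomorphic[where a = "\<lambda>k. of_real (q k)"]) (use sums in auto)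
  have L: "bounded_linear L"
    unfolding L_def
    by (intro bounded_linear_Pair bounded_linear_compose[OF bounded_linear_scaleR_left]
        bounded_linear_Re bounded_linear_Im)
  have "C1_Cauchy_Riemann F"
    unfolding C1_Cauchy_Riemann_def
  proof (intro exI conjI ballI)
    \<comment> \<open>Multiplication by \<open>deriv g z\<close> followed by \<open>L\<close>. Since
      \<open>L (\<i> * w)\<close> has components \<open>- Im w\<close> and \<open>Re w\<close>, the
      Cauchy-Riemann equations can be read off.\<close>
    let ?F' = "\<lambda>z. Blinfun L o\<^sub>L blinfun_mult_right (deriv g z)"
    show "continuous_on (ball 0 1) ?F'"
      by (intro continuous_intros bounded_linear.continuous_on[OF bounded_linear_blinfun_mult_right]
          holomorphic_on_imp_continuous_on holomorphic_deriv holg) auto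
    fix z :: complex assume z: "z \<in> ball 0 1"
    have "(g has_field_derivative deriv g z) (at z)"
      using holg z by (simp add: holomorphic_derivI[of g "ball 0 1"])
    then have "(g has_derivative (\<lambda>w. deriv g z * w)) (at z)"
      by (simp add: has_field_derivative_def)
    from bounded_linear.has_derivative[OF L this]
    show "(F has_derivative blinfun_apply (?F' z)) (at z)"
      by (simp add: F_def blinfun_compose.rep_eq bounded_linear_Blinfun_apply[OF L] o_def)
  qed (simp_all add: bounded_linear_Blinfun_apply[OF L] L_def)
  moreover have "stem_function F"
    unfolding stem_function_def
  proof
    fix z :: complex assume "z \<in> ball 0 1"
    then have z: "norm z < 1" by simp
    have "(\<lambda>k. cnj (of_real (q k) * z ^ k)) sums cnj (g z)"
      using sums[OF z] by (simp only: sums_cnj)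
    moreover have "(\<lambda>k. of_real (q k) * cnj z ^ k) sums g (cnj z)"
      by (rule sums) (use z in simp)
    ultimately have "g (cnj z) = cnj (g z)"
      using sums_unique2 by fastforce
    then show "fst (F (cnj z)) = fst (F z) \<and> snd (F (cnj z)) = - snd (F z)"
      by (simp add: F_def L_def)
  qed
  moreover have "induced_by f F"
    unfolding induced_by_def
  proof (intro ballI allI impI)
    fix I \<alpha> \<beta> assume I: "I \<in> imag_units" and "Complex \<alpha> \<beta> \<in> ball 0 1"
    then have "f (\<alpha> *\<^sub>R 1\<^sub>o + \<beta> *\<^sub>R I) = Re (g (Complex \<alpha> \<beta>)) *\<^sub>R 1\<^sub>o + Im (g (Complex \<alpha> \<beta>)) *\<^sub>R I"
      using slice_sums[of I \<alpha> \<beta>] by (simp add: imag_units_def f_def sums_iff)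
    then show "f (\<alpha> *\<^sub>R 1\<^sub>o + \<beta> *\<^sub>R I) = fst (F (Complex \<alpha> \<beta>)) + I \<cdot>\<^sub>o snd (F (Complex \<alpha> \<beta>))"
      by (simp add: F_def L_def omult_linear)
  qed
  ultimately have "f \<in> SRB"
    using on_ball by (auto simp: SRB_def slice_regular_def)
  moreover have "has_expansion f (\<lambda>k. q k *\<^sub>R 1\<^sub>o)"
    using on_ball by (simp add: has_expansion_def)
  ultimately show ?thesis by blast
qed

section \<open>Extremal functions\<close>

text \<open>The Taylor coefficients at 0 of \<open>(c - z) / (1 - c * z)\<close>.\<close>

definition moebius_coeff :: "real \<Rightarrow> nat \<Rightarrow> real"
  where "moebius_coeff c n = (if n = 0 then c else - (1 - c\<^sup>2) * c ^ (n - 1))"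

lemma SRB_moebius:
  assumes c: "0 < c" "c < 1"
  shows "\<exists>f\<in>SRB. has_expansion f (\<lambda>k. moebius_coeff c k *\<^sub>R 1\<^sub>o)"
proof (rule SRB_of_real_powser)
  fix z :: complex assume z: "norm z < 1"
  let ?c = "complex_of_real c"
  have "norm (?c * z) < 1 * 1"
    unfolding norm_mult by (rule mult_strict_mono') (use c z in auto)
  then have cz: "norm (?c * z) < 1" by simp
  then have nz: "1 - ?c * z \<noteq> 0" by auto
  \<comment> \<open>Geometric expansion of the second term in \<open>(c - z) / (1 - c * z) = c - (1
    - c\<^sup>2) * z / (1 - c * z)\<close>.\<close>
  have "(\<lambda>k. - (1 - ?c\<^sup>2) * z * (?c * z) ^ k) sums (- (1 - ?c\<^sup>2) * z * (1 / (1 - ?c * z)))"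
    by (intro sums_mult geometric_sums cz)
  also have "(\<lambda>k. - (1 - ?c\<^sup>2) * z * (?c * z) ^ k) = (\<lambda>k. of_real (moebius_coeff c (Suc k)) * z ^ Suc k)"
    by (simp add: moebius_coeff_def power_mult_distrib mult_ac)
  finally have "(\<lambda>k. of_real (moebius_coeff c k) * z ^ k)
      sums (- (1 - ?c\<^sup>2) * z * (1 / (1 - ?c * z)) + of_real (moebius_coeff c 0) * z ^ 0)"
    by (rule sums_Suc[where f = "\<lambda>k. of_real (moebius_coeff c k) * z ^ k"])
  also have "- (1 - ?c\<^sup>2) * z * (1 / (1 - ?c * z)) + of_real (moebius_coeff c 0) * z ^ 0
      = - Moebius_function 0 ?c z"
    using nz by (simp add: moebius_coeff_def Moebius_function_def field_simps power2_eq_square)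
  finally show "(\<lambda>k. of_real (moebius_coeff c k) * z ^ k) sums (- Moebius_function 0 ?c z)" .
  have "norm (Moebius_function 0 ?c z) < 1"
    by (rule Moebius_function_norm_lt_1) (use c z in auto)
  then show "norm (- Moebius_function 0 ?c z) \<le> 1" by simp
qed

section \<open>The coefficient estimate on the octonions\<close>

lemma SRB_coeff_le:
  assumes f: "f \<in> SRB" and exp: "has_expansion f a" and n: "0 < n"
  shows "norm (a n) \<le> 1 - (norm (a 0))\<^sup>2"
proof -
  define u where "u = (if a 0 = 0 then 1\<^sub>o else a 0 /\<^sub>R norm (a 0))"
  have u: "norm u = 1" by (simp add: u_def oone_def norm_Pair)
  have a0: "a 0 = norm (a 0) *\<^sub>R u" by (simp add: u_def)
  \<comment> \<open>The slice is chosen so that \<open>a 0\<close> and \<open>a n\<close> lie on one complex line \<open>\<complex>\<^sub>I u\<close>.  In a slice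
    without this property only the weaker bound \<open>sqrt (1 - (norm (a 0))\<^sup>2)\<close> is available.\<close>
  obtain I \<gamma> \<delta> where I: "I \<in> imag_sphere" and quot: "a n \<cdot>\<^sub>o ocnj u = \<gamma> *\<^sub>R 1\<^sub>o + \<delta> *\<^sub>R I"
    by (rule imag_sphere_decomp)
  have "a n = (\<gamma> *\<^sub>R 1\<^sub>o + \<delta> *\<^sub>R I) \<cdot>\<^sub>o u"
    unfolding quot[symmetric] by (simp add: omult_ocnj_cancel u)
  then have an: "a n = \<gamma> *\<^sub>R u + \<delta> *\<^sub>R (I \<cdot>\<^sub>o u)"
    and coord_an: "slice_coord I u (a n) = Complex \<gamma> \<delta> * slice_coord I u u"
    using slice_coord_slice[OF I, of u \<gamma> \<delta> u] by (simp_all add: omult_linear)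
  have [simp]: "slice_coord I u u = 1"
    using u inner_omult_imag[of I u u] I
    by (simp add: slice_coord_def imag_sphere_def complex_eq_iff norm_eq_1 inner_commute)
  define b where "b k = slice_coord I u (a k)" for k
  define g where "g z = slice_coord I u (f (Re z *\<^sub>R 1\<^sub>o + Im z *\<^sub>R I))" for z
  have one: "norm 1\<^sub>o = 1" by (simp add: oone_def norm_Pair)
  have ball: "Re z *\<^sub>R 1\<^sub>o + Im z *\<^sub>R I \<in> ball 0 1" if "norm z < 1" for z
    using that norm_slice[OF I one, of "Re z" "Im z"] by simp
  have "norm (b n) \<le> 1 - (norm (b 0))\<^sup>2"
  proof (rule bounded_powser_coeff_le[OF _ _ n])
    fix z :: complex assume z: "norm z < 1"
    have "(\<lambda>k. slice_coord I u (opow (Re z *\<^sub>R 1\<^sub>o + Im z *\<^sub>R I) k \<cdot>\<^sub>o a k)) sums g z"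
      unfolding g_def using exp ball[OF z]
      by (intro bounded_linear.sums[OF bounded_linear_slice_coord]) (simp add: has_expansion_def)
    \<comment> \<open>Powers of a slice element stay in the slice, so complex linearity pulls them
      out as \<open>z ^ k\<close>.\<close>
    moreover have "slice_coord I u (opow (Re z *\<^sub>R 1\<^sub>o + Im z *\<^sub>R I) k \<cdot>\<^sub>o a k) = b k * z ^ k" for k
      by (simp add: opow_slice[OF imag_sphere_square[OF I]] slice_coord_slice[OF I] b_def mult.commute)
    ultimately show "(\<lambda>k. b k * z ^ k) sums g z" by simp
    show "norm (g z) \<le> 1"
      unfolding g_def
      using f ball[OF z] by (intro order_trans[OF norm_slice_coord_le[OF I u]]) (simp add: SRB_def)
  qed
  \<comment> \<open>The projection loses nothing here, because \<open>a n\<close> lies on the line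
    projected onto.\<close>
  moreover have "norm (b n) = norm (a n)"
    unfolding b_def coord_an by (simp add: an norm_slice[OF I u])
  moreover have "b 0 = of_real (norm (a 0))"
    using a0 linear_scale[OF bounded_linear.linear[OF bounded_linear_slice_coord], of I u "norm (a 0)" u]
    by (simp add: b_def scaleR_conv_of_real)
  ultimately show ?thesis by simp
qed

section \<open>The Bohr radius\<close>

text \<open>Sums the termwise majorant of \<open>cesaro_coeff_upper\<close>; nonnegativity of the
  terms then yields convergence too. It serves with the sharp \<open>t = 1 - s\<^sup>2\<close> and,
  for mere convergence, with \<open>s = t = 1\<close>.\<close>

lemma cesaro_sum_upper:
  fixes \<beta> r :: real
  assumes \<beta>: "0 < \<beta>" "\<beta> \<noteq> 1" and r: "0 < r" "r < 1"
    and a0: "norm (a 0) \<le> s" and an: "\<And>n. 0 < n \<Longrightarrow> norm (a n) \<le> t"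
  defines "A \<equiv> 1 / r * ((1 - (1 - r) powr (1 - \<beta>)) / (1 - \<beta>))"
    and "B \<equiv> 1 / r * (((1 - r) powr - \<beta> - 1) / \<beta>)"
  shows "summable (\<lambda>k. r ^ k * cesaro_coeff \<beta> a k)"
    and "(\<Sum>k. r ^ k * cesaro_coeff \<beta> a k) \<le> s * A + t * (B - A)"
proof -
  let ?c = "\<lambda>k. r ^ k * (pochhammer \<beta> k / fact k / (real k + 1))"
  let ?d = "\<lambda>k. r ^ k * (pochhammer (\<beta> + 1) k / fact k / (real k + 1))"
  have "?c sums A" and "?d sums B"
    unfolding A_def B_def
    using pochhammer_mean_series_sums[OF r] pochhammer_Suc_mean_series_sums[OF r] \<beta> by auto
  then have maj: "(\<lambda>k. s * ?c k + t * (?d k - ?c k)) sums (s * A + t * (B - A))"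
    by (intro sums_add sums_mult sums_diff)
  have le: "r ^ k * cesaro_coeff \<beta> a k \<le> s * ?c k + t * (?d k - ?c k)" for k
    using mult_left_mono[OF cesaro_coeff_upper[of \<beta> a s k t], of "r ^ k"] \<beta> a0 an r
    by (simp add: algebra_simps)
  show sm: "summable (\<lambda>k. r ^ k * cesaro_coeff \<beta> a k)"
    by (rule summable_comparison_test'[OF sums_summable[OF maj]])
      (use le cesaro_coeff_nonneg[OF \<beta>(1)] r in simp)
  show "(\<Sum>k. r ^ k * cesaro_coeff \<beta> a k) \<le> s * A + t * (B - A)"
    by (rule sums_le[OF le summable_sums[OF sm] maj])
qed

text \<open>Near \<open>c = 1\<close> the sum for the Moebius coefficients exceeds \<open>A\<close> by about
  \<open>(1 - c) * (2 * (B - A) - A)\<close>; truncating the nonnegative tail of the series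
  at \<open>K\<close> makes the lower bound a polynomial in \<open>c\<close>.\<close>

lemma moebius_cesaro_sum_gt:
  fixes \<beta> r :: real
  assumes \<beta>: "0 < \<beta>" "\<beta> \<noteq> 1" and r: "0 < r" "r < 1"
  defines "A \<equiv> 1 / r * ((1 - (1 - r) powr (1 - \<beta>)) / (1 - \<beta>))"
    and "B \<equiv> 1 / r * (((1 - r) powr - \<beta> - 1) / \<beta>)"
  assumes AB: "A < 2 * (B - A)"
  obtains c where "0 < c" "c < 1"
    "summable (\<lambda>k. r ^ k * cesaro_coeff \<beta> (\<lambda>k. moebius_coeff c k *\<^sub>R 1\<^sub>o) k)"
    "A < (\<Sum>k. r ^ k * cesaro_coeff \<beta> (\<lambda>k. moebius_coeff c k *\<^sub>R 1\<^sub>o) k)"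
proof -
  let ?c = "\<lambda>k. r ^ k * (pochhammer \<beta> k / fact k / (real k + 1))"
  let ?d = "\<lambda>k. r ^ k * (pochhammer (\<beta> + 1) k / fact k / (real k + 1))"
  have c_sums: "?c sums A" and "?d sums B"
    unfolding A_def B_def
    using pochhammer_mean_series_sums[OF r] pochhammer_Suc_mean_series_sums[OF r] \<beta> by auto
  then have "(\<lambda>k. ?d k - ?c k) sums (B - A)"
    by (intro sums_diff)
  then have "(\<lambda>K. \<Sum>k<K. ?d k - ?c k) \<longlonglongrightarrow> B - A"
    by (simp add: sums_def)
  moreover have "A / 2 < B - A" using AB by simp
  ultimately have "eventually (\<lambda>K. A / 2 < (\<Sum>k<K. ?d k - ?c k)) sequentially"
    by (rule order_tendstoD)
  then obtain K where K: "A / 2 < (\<Sum>k<K. ?d k - ?c k)"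
    using eventually_happens by force
  define T where "T = (\<Sum>k<K. ?d k - ?c k)"
  \<comment> \<open>At \<open>c = 1\<close> this polynomial equals \<open>2 * T\<close>, which
    exceeds \<open>A\<close> by the choice of \<open>K\<close>.\<close>
  have "((\<lambda>c. (1 + c) * c ^ K * T) \<longlongrightarrow> (1 + 1) * 1 ^ K * T) (at_left 1)"
    by (intro tendsto_intros)
  moreover have "A < (1 + 1) * 1 ^ K * T" using K by (simp add: T_def)
  ultimately have "eventually (\<lambda>c. A < (1 + c) * c ^ K * T) (at_left 1)"
    by (rule order_tendstoD)
  moreover have "eventually (\<lambda>c. c \<in> {0<..<1}) (at_left (1::real))"
    by (rule eventually_at_left_real) simp
  ultimately have "eventually (\<lambda>c. A < (1 + c) * c ^ K * T \<and> c \<in> {0<..<1}) (at_left 1)"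
    by (rule eventually_conj)
  then obtain c where c: "A < (1 + c) * c ^ K * T" "0 < c" "c < 1"
    using eventually_happens'[of "at_left (1 :: real)"] by auto
  define a where "a k = moebius_coeff c k *\<^sub>R 1\<^sub>o" for k
  have c2: "0 < 1 - c\<^sup>2" using c by (simp add: power_less_one_iff)
  have norm_a: "norm (a n) = (if n = 0 then c else (1 - c\<^sup>2) * c ^ (n - 1))" for n
    using c c2 by (simp add: a_def moebius_coeff_def oone_def norm_Pair abs_mult)
  have norm_a_le1: "norm (a n) \<le> 1" for n
    using c c2 by (auto simp: norm_a intro!: mult_le_one power_le_one)
  have sm: "summable (\<lambda>k. r ^ k * cesaro_coeff \<beta> a k)"
    by (rule cesaro_sum_upper(1)[OF \<beta> r, of a 1 1]) (use norm_a_le1 in auto)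
  \<comment> \<open>The minorant keeps the full series of \<open>A\<close> but only the first
    \<open>K\<close> terms of the series of \<open>B - A\<close>.\<close>
  let ?m = "\<lambda>k. c * ?c k + (if k \<in> {..<K} then (1 - c\<^sup>2) * c ^ K * (?d k - ?c k) else 0)"
  have le: "?m k \<le> r ^ k * cesaro_coeff \<beta> a k" for k
  proof -
    \<comment> \<open>For \<open>k < K\<close> every \<open>n\<close> in \<open>{1..k}\<close> has
      \<open>n - 1 \<le> K\<close>, so \<open>c ^ K\<close> is a common lower bound of the powers;
      beyond \<open>K\<close> the bound 0 suffices.\<close>
    define t where "t = (if k \<in> {..<K} then (1 - c\<^sup>2) * c ^ K else 0)"
    have "t \<le> norm (a n)" if n: "n \<in> {1..k}" for n
      using n c c2 by (auto simp: t_def norm_a intro!: mult_left_mono power_decreasing)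
    then have "r ^ k * (c * (pochhammer \<beta> k / fact k / (real k + 1)) +
        t * (pochhammer (\<beta> + 1) k / fact k / (real k + 1) - pochhammer \<beta> k / fact k / (real k + 1)))
        \<le> r ^ k * cesaro_coeff \<beta> a k"
      using r \<beta> by (intro mult_left_mono cesaro_coeff_lower) (auto simp: norm_a)
    then show ?thesis by (simp add: t_def algebra_simps split: if_splits)
  qed
  have "?m sums (c * A + (\<Sum>k<K. (1 - c\<^sup>2) * c ^ K * (?d k - ?c k)))"
    by (intro sums_add sums_mult c_sums sums_If_finite_set) simp
  then have "c * A + (\<Sum>k<K. (1 - c\<^sup>2) * c ^ K * (?d k - ?c k)) \<le> (\<Sum>k. r ^ k * cesaro_coeff \<beta> a k)"
    by (rule sums_le[OF le _ summable_sums[OF sm]])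
  moreover have "(\<Sum>k<K. (1 - c\<^sup>2) * c ^ K * (?d k - ?c k)) = (1 - c) * ((1 + c) * c ^ K * T)"
    unfolding T_def sum_distrib_left[symmetric] by (simp add: power2_eq_square algebra_simps)
  \<comment> \<open>Subtracting \<open>c * A\<close> from both sides leaves a common factor
    \<open>1 - c\<close>, which reduces the claim to the choice of \<open>c\<close>.\<close>
  moreover have "(1 - c) * A < (1 - c) * ((1 + c) * c ^ K * T)"
    using c by (intro mult_strict_left_mono) auto
  ultimately have "A < (\<Sum>k. r ^ k * cesaro_coeff \<beta> a k)"
    by (simp add: algebra_simps)
  with sm c show ?thesis
    unfolding a_def by (intro that)
qed

text \<open>Summability is asserted in both halves, since the value of \<open>suminf\<close> carries
  no information for a divergent series.\<close>

theorem theorem2p1: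
  fixes \<beta> R :: real
  assumes "0 < \<beta>" and "\<beta> \<noteq> 1"
    and "0 < R" and "R < 1" and "radius_fun \<beta> R = 0"
  shows "(\<forall>f\<in>SRB. \<forall>a. has_expansion f a \<longrightarrow>
            (\<forall>(x::octonion) r. x \<in> ball 0 1 \<and> 0 < norm x \<and> norm x = r \<and> r \<le> R \<longrightarrow>
              summable (\<lambda>k. norm x ^ k * cesaro_coeff \<beta> a k) \<and>
              (\<Sum>k. norm x ^ k * cesaro_coeff \<beta> a k)
                \<le> 1 / r * ((1 - (1 - r) powr (1 - \<beta>)) / (1 - \<beta>))))
       \<and> (\<forall>r. R < r \<and> r < 1 \<longrightarrow>
            (\<exists>f\<in>SRB. \<exists>a. has_expansion f a \<and>
              (\<forall>x::octonion. norm x = r \<longrightarrow>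
                summable (\<lambda>k. norm x ^ k * cesaro_coeff \<beta> a k) \<and>
                (\<Sum>k. norm x ^ k * cesaro_coeff \<beta> a k)
                  > 1 / r * ((1 - (1 - r) powr (1 - \<beta>)) / (1 - \<beta>)))))"
proof -
  define A where "A r = 1 / r * ((1 - (1 - r) powr (1 - \<beta>)) / (1 - \<beta>))" for r
  define B where "B r = 1 / r * (((1 - r) powr - \<beta> - 1) / \<beta>)" for r
  have radius: "radius_fun \<beta> r = r * (A r - 2 * (B r - A r))" if "0 < r" for r
  proof -
    have "radius_fun \<beta> r = 3 * (r * A r) - 2 * (r * B r)"
      using that by (simp add: radius_fun_def A_def B_def)
    then show ?thesis by (simp add: algebra_simps)
  qed
  have upper: "summable (\<lambda>k. r ^ k * cesaro_coeff \<beta> a k) \<and> (\<Sum>k. r ^ k * cesaro_coeff \<beta> a k) \<le> A r"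
    if f: "f \<in> SRB" "has_expansion f a" and r: "0 < r" "r \<le> R" for f a r
  proof -
    define s where "s = norm (a 0)"
    have an: "norm (a n) \<le> 1 - s\<^sup>2" if "0 < n" for n
      unfolding s_def by (rule SRB_coeff_le[OF f that])
    \<comment> \<open>The bound on \<open>norm (a 1)\<close> must itself be nonnegative.\<close>
    have "s\<^sup>2 \<le> 1" using an[of 1] norm_ge_zero[of "a 1"] by linarith
    then have s: "s \<le> 1" by (simp add: power_le_one_iff s_def)
    note sum = cesaro_sum_upper[OF assms(1,2) r(1) order.strict_trans1[OF r(2) assms(4)],
        of a s "1 - s\<^sup>2", folded A_def B_def]
    have "0 \<le> B r - A r"
      using powr_mean_le[OF r(1) order.strict_trans1[OF r(2) assms(4)] assms(1,2)]
      by (simp add: A_def B_def)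
    moreover have "2 * (B r - A r) \<le> A r"
      using radius_fun_sign(1)[OF assms r] radius[OF r(1)] r(1) by (simp add: zero_le_mult_iff)
    \<comment> \<open>Here \<open>1 + s \<le> 2\<close> is combined with
      \<open>A r \<le> B r\<close>; multiplying by \<open>1 - s\<close> afterwards produces the
      factor \<open>1 - s\<^sup>2\<close> of the coefficient estimate.\<close>
    ultimately have "(1 + s) * (B r - A r) \<le> A r"
      using mult_right_mono[of "1 + s" 2 "B r - A r"] s by linarith
    then have "(1 - s) * ((1 + s) * (B r - A r)) \<le> (1 - s) * A r"
      using s by (intro mult_left_mono) auto
    then have "s * A r + (1 - s\<^sup>2) * (B r - A r) \<le> A r"
      by (simp add: power2_eq_square algebra_simps)
    with sum an show ?thesis by (force simp: s_def)
  qed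
  moreover have "\<exists>f\<in>SRB. \<exists>a. has_expansion f a \<and> summable (\<lambda>k. r ^ k * cesaro_coeff \<beta> a k) \<and>
      A r < (\<Sum>k. r ^ k * cesaro_coeff \<beta> a k)" if r: "R < r" "r < 1" for r
  proof -
    have r0: "0 < r" using r assms by simp
    have "A r < 2 * (B r - A r)"
      using radius_fun_sign(2)[OF assms r] radius[OF r0] r0 by (simp add: mult_less_0_iff)
    then obtain c where "0 < c" "c < 1"
      "summable (\<lambda>k. r ^ k * cesaro_coeff \<beta> (\<lambda>k. moebius_coeff c k *\<^sub>R 1\<^sub>o) k)"
      "A r < (\<Sum>k. r ^ k * cesaro_coeff \<beta> (\<lambda>k. moebius_coeff c k *\<^sub>R 1\<^sub>o) k)"
      using moebius_cesaro_sum_gt[OF assms(1,2) r0 r(2)] unfolding A_def B_def by blast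
    with SRB_moebius show ?thesis by blast
  qed
  ultimately show ?thesis
    unfolding A_def by fastforce
qed

end
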